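(* There is no semantics $S$ that is both order-based and filter-based.
   Context: Fix pairwise disjoint countably infinite sets $\mathbb V$ (vertex identifiers), $\mathbb E$ (edge identifiers), $\mathbb L$ (labels). Regular expressions are given by $R ::= \varepsilon \mid a \mid R^* \mid R\cdot R\mid R+R$ with $a\in\mathbb L$; $L(R)$ is the denoted language. A walk is a finite nonempty alternating sequence $w=(v_0,e_1,v_1,\dots,e_k,v_k)$ with $v_i\in\mathbb V$, $e_i\in\mathbb E$; its length is $k$ and its endpoints are the pair $(v_0,v_k)$. $\mathsf{Walks}$ is the set of all walks (independently of any database). A database $D=(L_D,V_D,E_D,\mathsf{Src}_D,\mathsf{Tgt}_D,\mathsf{Lbl}_D)$ consists of finite sets $L_D\subset\mathbb L$, $V_D\subset\mathbb V$, $E_D\subset\mathbb E$ and functions $\mathsf{Src}_D,\mathsf{Tgt}_D:E_D\to V_D$, $\mathsf{Lbl}_D:E_D\to L_D$. $\mathsf{Walks}(D)$ is the set of walks $(v_0,e_1,\dots,e_k,v_k)$ with all $v_i\in V_D$, $e_i\in E_D$, $\mathsf{Src}_D(e_i)=v_{i-1}$ and $\mathsf{Tgt}_D(e_i)=v_i$; the label $\mathsf{Lbl}_D(w)$ of such a walk is the word $\mathsf{Lbl}_D(e_1)\cdots\mathsf{Lbl}_D(e_k)$. $\mathsf{Matches}(D,R)=\{w\in\mathsf{Walks}(D): \mathsf{Lbl}_D(w)\in L(R)\}$, and $\mathsf{Matches}(D,R,s,t)$ is the set of those $w\in \mathsf{Matches}(D,R)$ with endpoints $(s,t)$. A semantics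 $S$ is a function mapping every database $D$ and regular expression $R$ to a finite subset $S(D,R)$ of $\mathsf{Matches}(D,R)$. $S$ is filter-based if there is a function $f:\mathsf{Walks}\to\{\top,\bot\}$ with $S(D,R)=\{w\in\mathsf{Matches}(D,R): f(w)=\top\}$ for all $D,R$. A partial order $\preceq$ on $\mathsf{Walks}$ is suitable if for every database $D$ its restriction to $\mathsf{Walks}(D)$ is a well-partial-order (every infinite sequence $x_1,x_2,\dots$ has $i<j$ with $x_i\preceq x_j$). $S$ is order-based if there is a suitable order $\preceq$ with $S(D,R)=\bigcup_{s,t\in V_D}\min_\preceq \mathsf{Matches}(D,R,s,t)$ for all $D,R$, where $\min_\preceq X$ is the set of $\preceq$-minimal elements of $X$. *)

theory Defs
  imports Main "HOL-Library.FuncSet" "HOL-Library.Countable" "HOL-Library.Infinite_Typeclass"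
begin

text \<open>
  Vertex identifiers, edge identifiers and labels are drawn from three types \<open>'v\<close>, \<open>'e\<close>, \<open>'l\<close>;
  being countably infinite is imposed by the sort \<open>{countable,infinite}\<close> in the theorem.
\<close>

datatype 'l rexp =
    Eps
  | Atom 'l
  | Star "'l rexp"
  | Conc "'l rexp" "'l rexp"
  | Plus "'l rexp" "'l rexp"

primrec lang :: "'l rexp \<Rightarrow> 'l list set" where
  "lang Eps = {[]}"
| "lang (Atom a) = {[a]}"
| "lang (Star r) = concat ` lists (lang r)"
| "lang (Conc r s) = {u @ v |u v. u \<in> lang r \<and> v \<in> lang s}"
| "lang (Plus r s) = lang r \<union> lang s"

text \<open>
  The walk \<open>(v\<^sub>0, e\<^sub>1, v\<^sub>1, \<dots>, e\<^sub>k, v\<^sub>k)\<close> is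
  \<open>Step v\<^sub>0 e\<^sub>1 (Step v\<^sub>1 e\<^sub>2 (\<dots> (Vertex v\<^sub>k)))\<close>.
  Every element of this type is a walk, whether or not it lies in some database.
\<close>

datatype ('v, 'e) walk = Vertex 'v | Step 'v 'e "('v, 'e) walk"

primrec first :: "('v, 'e) walk \<Rightarrow> 'v" where
  "first (Vertex v) = v"
| "first (Step v e w) = v"

primrec final :: "('v, 'e) walk \<Rightarrow> 'v" where
  "final (Vertex v) = v"
| "final (Step v e w) = final w"

definition endpoints :: "('v, 'e) walk \<Rightarrow> 'v \<times> 'v" where
  "endpoints w = (first w, final w)"

record ('v, 'e, 'l) database =
  Labels :: "'l set"
  Verts :: "'v set"
  Edges :: "'e set"
  Src :: "'e \<Rightarrow> 'v"
  Tgt :: "'e \<Rightarrow> 'v"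
  Lbl :: "'e \<Rightarrow> 'l"

text \<open>
  The extensional function space makes the three maps genuine functions on \<open>Edges D\<close>, so that
  databases with the same restrictions to \<open>Edges D\<close> are equal.
\<close>

definition is_database :: "('v, 'e, 'l) database \<Rightarrow> bool" where
  "is_database D \<longleftrightarrow>
     finite (Labels D) \<and> finite (Verts D) \<and> finite (Edges D) \<and>
     Src D \<in> Edges D \<rightarrow>\<^sub>E Verts D \<and>
     Tgt D \<in> Edges D \<rightarrow>\<^sub>E Verts D \<and>
     Lbl D \<in> Edges D \<rightarrow>\<^sub>E Labels D"

primrec walk_in :: "('v, 'e, 'l) database \<Rightarrow> ('v, 'e) walk \<Rightarrow> bool" where
  "walk_in D (Vertex v) \<longleftrightarrow> v \<in> Verts D"
| "walk_in D (Step v e w) \<longleftrightarrow>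
     v \<in> Verts D \<and> e \<in> Edges D \<and> Src D e = v \<and> Tgt D e = first w \<and> walk_in D w"

definition walks :: "('v, 'e, 'l) database \<Rightarrow> ('v, 'e) walk set" where
  "walks D = {w. walk_in D w}"

primrec walk_label :: "('v, 'e, 'l) database \<Rightarrow> ('v, 'e) walk \<Rightarrow> 'l list" where
  "walk_label D (Vertex v) = []"
| "walk_label D (Step v e w) = Lbl D e # walk_label D w"

definition matches :: "('v, 'e, 'l) database \<Rightarrow> 'l rexp \<Rightarrow> ('v, 'e) walk set" where
  "matches D R = {w \<in> walks D. walk_label D w \<in> lang R}"

definition matches_between ::
    "('v, 'e, 'l) database \<Rightarrow> 'l rexp \<Rightarrow> 'v \<Rightarrow> 'v \<Rightarrow> ('v, 'e) walk set" where
  "matches_between D R s t = {w \<in> matches D R. endpoints w = (s, t)}"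

text \<open>
  A candidate semantics is a total HOL function; only its values at records satisfying
  \<^const>\<open>is_database\<close> carry meaning, and all conditions below are restricted to those.
\<close>

type_synonym ('v, 'e, 'l) evaluation =
  "('v, 'e, 'l) database \<Rightarrow> 'l rexp \<Rightarrow> ('v, 'e) walk set"

definition is_semantics :: "('v, 'e, 'l) evaluation \<Rightarrow> bool" where
  "is_semantics S \<longleftrightarrow>
     (\<forall>D R. is_database D \<longrightarrow> finite (S D R) \<and> S D R \<subseteq> matches D R)"

definition filter_based :: "('v, 'e, 'l) evaluation \<Rightarrow> bool" where
  "filter_based S \<longleftrightarrow>
     (\<exists>f :: ('v, 'e) walk \<Rightarrow> bool. \<forall>D R. is_database D \<longrightarrow> S D R = {w \<in> matches D R. f w})"

definition wpo_on :: "'a set \<Rightarrow> 'a rel \<Rightarrow> bool" where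
  "wpo_on A r \<longleftrightarrow>
     partial_order_on A r \<and>
     (\<forall>x :: nat \<Rightarrow> 'a. range x \<subseteq> A \<longrightarrow> (\<exists>i j. i < j \<and> (x i, x j) \<in> r))"

text \<open>
  Suitability quantifies over all databases, hence depends on the label type, which does not occur
  in the type of the order; the extra argument fixes it.
\<close>

definition suitable :: "'l itself \<Rightarrow> ('v, 'e) walk rel \<Rightarrow> bool" where
  "suitable _ r \<longleftrightarrow>
     partial_order_on UNIV r \<and>
     (\<forall>D :: ('v, 'e, 'l) database. is_database D \<longrightarrow> wpo_on (walks D) (Restr r (walks D)))"

definition minimal_elements :: "'a rel \<Rightarrow> 'a set \<Rightarrow> 'a set" where
  "minimal_elements r X = {x \<in> X. \<forall>y\<in>X. (y, x) \<in> r \<longrightarrow> y = x}"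

definition order_based :: "('v, 'e, 'l) evaluation \<Rightarrow> bool" where
  "order_based S \<longleftrightarrow>
     (\<exists>r. suitable TYPE('l) r \<and>
       (\<forall>D R. is_database D \<longrightarrow>
          S D R = (\<Union>s\<in>Verts D. \<Union>t\<in>Verts D. minimal_elements r (matches_between D R s t))))"

end

theory Submission
  imports Defs
begin

text \<open>
  In the database with one vertex and one loop, labelled \<open>a\<close>, there is exactly one walk \<open>w\<^sub>k\<close>
  with label \<open>a\<^sup>k\<close> for each \<open>k\<close>. As the only match of the expression \<open>a\<^sup>k\<close> it is minimal for any
  order, so a filter agreeing with an order-based semantics accepts every \<open>w\<^sub>k\<close>. The semantics then
  returns infinitely many walks for the expression \<open>a\<^sup>*\<close>.
\<close>

text \<open>The maps are restricted to \<open>{e}\<close> because \<open>is_database\<close> demands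
  extensional functions.\<close>

definition loop_db :: "'v \<Rightarrow> 'e \<Rightarrow> 'l \<Rightarrow> ('v, 'e, 'l) database" where
  "loop_db v e a = \<lparr>Labels = {a}, Verts = {v}, Edges = {e},
     Src = (\<lambda>x\<in>{e}. v), Tgt = (\<lambda>x\<in>{e}. v), Lbl = (\<lambda>x\<in>{e}. a)\<rparr>"

definition loop_walk :: "'v \<Rightarrow> 'e \<Rightarrow> nat \<Rightarrow> ('v, 'e) walk" where
  "loop_walk v e k = (Step v e ^^ k) (Vertex v)"

definition rexp_power :: "'l rexp \<Rightarrow> nat \<Rightarrow> 'l rexp" where
  "rexp_power r k = (Conc r ^^ k) Eps"

lemma is_database_loop_db: "is_database (loop_db v e a)"
  by (auto simp: is_database_def loop_db_def)

lemma first_loop_walk [simp]: "first (loop_walk v e k) = v"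
  by (cases k) (simp_all add: loop_walk_def)

lemma final_loop_walk [simp]: "final (loop_walk v e k) = v"
  by (induction k) (simp_all add: loop_walk_def)

lemma walk_label_loop_walk:
  "walk_label (loop_db v e a) (loop_walk v e k) = replicate k a"
  by (induction k) (simp_all add: loop_walk_def loop_db_def)

lemma loop_walk_in_walks: "loop_walk v e k \<in> walks (loop_db v e a)"
proof (induction k)
  case 0
  show ?case by (simp add: walks_def loop_walk_def loop_db_def)
next
  case (Suc k)
  have "loop_walk v e (Suc k) = Step v e (loop_walk v e k)"
    by (simp add: loop_walk_def)
  with Suc show ?case by (simp add: walks_def loop_db_def)
qed

text \<open>With a single vertex and a single edge a walk has no choice but its length, and its
  label has that same length. Hence the label alone determines the walk.\<close>

lemma walk_in_loop_db:
  "walk_in (loop_db v e a) w \<Longrightarrow> w = loop_walk v e (length (walk_label (loop_db v e a) w))"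
  by (induction w) (simp_all add: loop_db_def loop_walk_def)

lemma lang_rexp_power_Atom: "lang (rexp_power (Atom a) k) = {replicate k a}"
  by (induction k) (simp_all add: rexp_power_def)

lemma replicate_in_lang_Star_Atom: "replicate k a \<in> lang (Star (Atom a))"
proof -
  have "concat (replicate k [a]) = replicate k a" by (induction k) simp_all
  moreover have "replicate k [a] \<in> lists {[a]}" by (induction k) auto
  ultimately show ?thesis by (metis image_eqI lang.simps(2,3))
qed

lemma matches_between_loop_db_power:
  "matches_between (loop_db v e a) (rexp_power (Atom a) k) v v = {loop_walk v e k}"
proof -
  have "w = loop_walk v e k"
    if "w \<in> walks (loop_db v e a)" "walk_label (loop_db v e a) w = replicate k a" for w
    using walk_in_loop_db[of v e a w] that by (simp add: walks_def)
  then show ?thesis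
    by (auto simp: matches_between_def matches_def lang_rexp_power_Atom loop_walk_in_walks
        walk_label_loop_walk endpoints_def)
qed

text \<open>The label read in \<open>loop_db v e a\<close>, for an arbitrary \<open>a\<close>, has
  length \<open>k\<close> and so recovers \<open>k\<close>.\<close>

lemma inj_loop_walk: "inj (loop_walk v e)"
proof (rule injI)
  fix k m
  assume "loop_walk v e k = loop_walk v e m"
  then show "k = m"
    by (metis length_replicate walk_label_loop_walk)
qed

theorem corollary43:
  "\<not> (\<exists>S :: ('v::{countable,infinite}, 'e::{countable,infinite}, 'l::{countable,infinite}) evaluation.
        is_semantics S \<and> order_based S \<and> filter_based S)"
proof
  assume "\<exists>S :: ('v, 'e, 'l) evaluation. is_semantics S \<and> order_based S \<and> filter_based S"
  then obtain S :: "('v, 'e, 'l) evaluation" and r f where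
    sem: "is_semantics S" and
    ord: "\<And>D R. is_database D \<Longrightarrow>
      S D R = (\<Union>s\<in>Verts D. \<Union>t\<in>Verts D. minimal_elements r (matches_between D R s t))" and
    flt: "\<And>D R. is_database D \<Longrightarrow> S D R = {w \<in> matches D R. f w}"
    unfolding order_based_def filter_based_def by blast
  \<comment> \<open>Arbitrary elements suffice, since every type is inhabited.\<close>
  fix v :: 'v and e :: 'e and a :: 'l
  let ?D = "loop_db v e a"
  have accepted: "f (loop_walk v e k)" for k
  proof -
    \<comment> \<open>The union over pairs of endpoints collapses to the pair \<open>v\<close>,
      \<open>v\<close>, leaving the minimal elements of a singleton.\<close>
    have "Verts ?D = {v}" by (simp add: loop_db_def)
    then have "loop_walk v e k \<in> S ?D (rexp_power (Atom a) k)"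
      by (simp add: ord is_database_loop_db matches_between_loop_db_power minimal_elements_def)
    then show ?thesis by (simp add: flt is_database_loop_db)
  qed
  \<comment> \<open>The filter does not see the expression, so acceptance carries over from the
    powers to the star. \<open>lang.simps\<close> stays folded so that
    \<open>replicate_in_lang_Star_Atom\<close> applies.\<close>
  have "range (loop_walk v e) \<subseteq> S ?D (Star (Atom a))"
    using accepted replicate_in_lang_Star_Atom
    by (auto simp: flt is_database_loop_db matches_def loop_walk_in_walks walk_label_loop_walk
        simp del: lang.simps)
  moreover have "finite (S ?D (Star (Atom a)))"
    using sem by (simp add: is_semantics_def is_database_loop_db)
  ultimately show False
    using inj_loop_walk finite_subset finite_imageD infinite_UNIV_nat by metis
qed

end
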